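(* Let $U_1,\dots,U_n$ be $n\ge 1$ i.i.d. random variables uniformly distributed on $(0,1)$, and let $\kappa=\pi^2/6$. For all $\delta\in(0,1)$, with probability at least $1-\delta$, $$\forall t\in(0,1),\quad n^{-1}\sum_{i=1}^n \mathbf 1\{U_i\le t\}\le t\,h^{-1}\!\left(\frac{\log(\kappa/\delta)+2\log(\lceil\log_2(1/t)\rceil)}{n\,g(t)}\right),$$ where $g(t)=2^{-\lceil\log_2(1/t)\rceil}/\bigl(1-2^{-\lceil\log_2(1/t)\rceil}\bigr)\ge t/2$. In particular, with probability at least $1-\delta$, $$\forall t\in(0,1),\quad n^{-1}\sum_{i=1}^n \mathbf 1\{U_i\le t\}\le t\,h^{-1}\!\left(\frac{2\log(\kappa/\delta)+4\log(1+\log_2(1/t))}{n\,t}\right).$$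
   Context: The function $h$ is defined by $h(\lambda)=\lambda(\log\lambda-1)+1$ for $\lambda>1$; it is an increasing bijection from $(1,\infty)$ onto $(0,\infty)$, and $h^{-1}:(0,\infty)\to(1,\infty)$ is its inverse. $\log$ is the natural logarithm and $\log_2$ the base-2 logarithm. *)

theory Defs
  imports "HOL-Probability.Probability"
begin

definition h :: "real \<Rightarrow> real" where
  "h l = l * (ln l - 1) + 1"

text \<open>The function \<open>h\<close> is only considered on \<open>(1,\<infinity>)\<close>; outside \<open>(0,\<infinity>)\<close> the value of
  \<open>h_inv\<close> is unspecified.\<close>

definition h_inv :: "real \<Rightarrow> real" where
  "h_inv = the_inv_into {1<..} h"

definition kappa :: real where
  "kappa = pi\<^sup>2 / 6"

definition dyadic_level :: "real \<Rightarrow> int" where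
  "dyadic_level t = \<lceil>log 2 (1 / t)\<rceil>"

definition g :: "real \<Rightarrow> real" where
  "g t = 2 powr (- real_of_int (dyadic_level t)) / (1 - 2 powr (- real_of_int (dyadic_level t)))"

lemma h_strict_mono_on: "strict_mono_on {1<..} h"
proof (rule strict_mono_onI)
  fix a b :: real assume ab: "a \<in> {1<..}" "b \<in> {1<..}" "a < b"
  show "h a < h b"
  proof (rule DERIV_pos_imp_increasing[OF \<open>a < b\<close>])
    fix x assume "a \<le> x" "x \<le> b"
    with ab have "1 < x" by simp
    then have "(h has_real_derivative ln x) (at x)"
      unfolding h_def[abs_def] by (auto intro!: derivative_eq_intros)
    with \<open>1 < x\<close> show "\<exists>y. (h has_real_derivative y) (at x) \<and> 0 < y"
      by (intro exI[of _ "ln x"]) simp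
  qed
qed

lemma h_pos: assumes "1 < x" shows "0 < h x"
proof -
  have "ln (1 / x) < 1 / x - 1"
    using assms ln_le_minus_one[of "1 / x"] ln_eq_minus_one[of "1 / x"] by fastforce
  then have "x * (1 - 1 / x) < x * ln x"
    using assms by (intro mult_strict_left_mono) (auto simp: ln_div)
  then show ?thesis using assms by (simp add: h_def algebra_simps)
qed

lemma h_bij_betw: "bij_betw h {1<..} {0<..}"
proof (rule bij_betw_imageI)
  show "inj_on h {1<..}"
    by (rule strict_mono_on_imp_inj_on[OF h_strict_mono_on])
  show "h ` {1<..} = {0<..}"
  proof (intro equalityI subsetI)
    fix y assume "y \<in> h ` {1<..}"
    then show "y \<in> {0<..}" using h_pos by auto
  next
    fix y :: real assume "y \<in> {0<..}"
    then have y: "0 < y" by simp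
    define b where "b = exp (1 + y)"
    have b: "1 < b" "y < h b"
    proof -
      show "1 < b" using y by (simp add: b_def)
      then have "y * 1 < y * b" using y by (intro mult_strict_left_mono)
      then show "y < h b" by (simp add: h_def b_def mult.commute)
    qed
    have "\<exists>x\<ge>1. x \<le> b \<and> h x = y"
    proof (rule IVT')
      show "h 1 \<le> y" using y by (simp add: h_def)
      show "continuous_on {1..b} h"
        unfolding h_def[abs_def] by (intro continuous_intros) auto
    qed (use b in auto)
    then obtain x where x: "1 \<le> x" "h x = y" by blast
    moreover have "x \<noteq> 1" using x y by (auto simp: h_def)
    ultimately show "y \<in> h ` {1<..}" by force
  qed
qed

end

theory Submission
  imports Defs
begin

text \<open>
  Let \<open>N t\<close> be the number of sample points in \<open>(0,t]\<close>. As \<open>t\<close> decreases, \<open>N t / t\<close> is a martingale, so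
  Doob's inequality for the submartingale \<open>exp (s N t / t)\<close> bounds the probability that
  \<open>N t / t\<close> exceeds \<open>n l\<close> somewhere on \<open>[a,1)\<close> by \<open>exp (-s n l) E (exp (s N a / a))\<close>. With Bennett's bound
  for the binomial moment generating function and \<open>s = a ln l / (1 - a)\<close> this is
  at most \<open>exp (- n a h l / (1 - a))\<close>. Taking \<open>a = 2^-k\<close> and choosing \<open>l\<close> so that the bound equals
  \<open>\<delta> / (\<kappa> k^2)\<close>, a union bound over \<open>k \<ge> 1\<close> concludes, since \<open>\<Sum> 1 / k^2 = \<kappa>\<close>.

  Doob's inequality holds on finite grids by a decomposition over the largest grid point at which the
  level \<open>L\<close> is exceeded; the supporting line of the convex function at \<open>L\<close> makes conditional
  expectations unnecessary.
\<close>

section \<open>Bennett's bound\<close>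

definition odds :: "real \<Rightarrow> real" where
  "odds p = p / (1 - p)"

lemma odds_pos: "0 < p \<Longrightarrow> p < 1 \<Longrightarrow> 0 < odds p"
  by (simp add: odds_def)

lemma le_odds:
  assumes "0 \<le> p" "p < 1"
  shows "p \<le> odds p"
proof -
  have "p * (1 - p) \<le> p"
    using assms by (intro mult_left_le) auto
  then show ?thesis
    using assms by (simp add: odds_def pos_le_divide_eq)
qed

lemma exp_minus_upper_Taylor_quadratic:
  fixes u :: real
  assumes "0 \<le> u"
  shows "exp (- u) \<le> 1 - u + u\<^sup>2 / 2"
proof -
  have "0 < ((u - 1)\<^sup>2 + 1) / 2"
    by (simp add: add_nonneg_pos)
  then have quadratic_pos: "0 < 1 - u + u\<^sup>2 / 2"
    by (simp add: power2_eq_square field_simps)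
  have "1 \<le> 1 + u ^ 4 / 4"
    by simp
  also have "\<dots> = (1 - u + u\<^sup>2 / 2) * (1 + u + u\<^sup>2 / 2)"
    by (simp add: power2_eq_square power4_eq_xxxx field_simps)
  also have "\<dots> \<le> (1 - u + u\<^sup>2 / 2) * exp u"
    using quadratic_pos exp_lower_Taylor_quadratic[OF assms] by (intro mult_left_mono) auto
  finally show ?thesis
    by (simp add: exp_minus divide_simps)
qed

text \<open>Bennett's inequality for the variable \<open>(B - a) / (1 - a)\<close>, which is bounded by \<open>1\<close> and has
  variance \<open>a / (1 - a)\<close> if \<open>B\<close> is Bernoulli with mean \<open>a\<close>.\<close>

lemma bernoulli_mgf_le_poisson_mgf:
  fixes a x :: real
  assumes "0 \<le> a" "a < 1" "0 \<le> x"
  shows "1 - a + a * exp (x / (1 - a)) \<le> exp (odds a * (exp x - 1))"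
proof -
  define c where "c = odds a"
  define r where "r = exp x - 1 - x"
  have c_nonneg: "0 \<le> c" and c_mult: "c * (1 - a) = a" and rescale: "x / (1 - a) = c * x + x"
    using assms by (auto simp: c_def odds_def field_simps)
  have "exp (- (c * x)) \<le> 1 - c * x + c\<^sup>2 * (x\<^sup>2 / 2)"
    using exp_minus_upper_Taylor_quadratic[of "c * x"] c_nonneg assms(3)
    by (simp add: power_mult_distrib)
  also have "\<dots> \<le> 1 - c * x + c\<^sup>2 * r"
    unfolding r_def using exp_lower_Taylor_quadratic[OF assms(3)]
    by (intro add_mono mult_left_mono) auto
  finally have "(1 - a) * exp (- (c * x)) + a * exp x \<le> (1 - a) * (1 - c * x + c\<^sup>2 * r) + a * exp x"
    using assms by (intro add_mono mult_left_mono) auto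
  also have "\<dots> = (1 - a) * (1 - c * x + c\<^sup>2 * r) + a * (r + 1 + x)"
    by (simp add: r_def)
  also have "\<dots> = 1 + (a + c * (1 - a) * c) * r + (a - c * (1 - a)) * x"
    by (simp add: power2_eq_square algebra_simps)
  also have "\<dots> = 1 + (a + a * c) * r"
    unfolding c_mult by simp
  also have "\<dots> = 1 + c * r"
    using c_mult by (simp add: algebra_simps)
  also have "\<dots> \<le> exp (c * r)"
    by (rule exp_ge_add_one_self)
  finally have "exp (c * x) * ((1 - a) * exp (- (c * x)) + a * exp x) \<le> exp (c * x) * exp (c * r)"
    by (intro mult_left_mono) auto
  also have "\<dots> = exp (c * (exp x - 1))"
    by (simp add: r_def algebra_simps flip: exp_add)
  also have "exp (c * x) * ((1 - a) * exp (- (c * x)) + a * exp x) = 1 - a + a * exp (x / (1 - a))"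
    unfolding rescale by (simp add: exp_minus exp_add algebra_simps)
  finally show ?thesis
    by (simp add: c_def)
qed

section \<open>A maximal inequality for reversed submartingales\<close>

definition last_exceedance :: "('t::linorder \<Rightarrow> 'a \<Rightarrow> real) \<Rightarrow> 't set \<Rightarrow> real \<Rightarrow> 't \<Rightarrow> 'a \<Rightarrow> bool" where
  "last_exceedance X T L t \<omega> \<longleftrightarrow> L < X t \<omega> \<and> (\<forall>u\<in>T. t < u \<longrightarrow> X u \<omega> \<le> L)"

lemma Ex_last_exceedance_iff:
  assumes "finite T"
  shows "(\<exists>t\<in>T. last_exceedance X T L t \<omega>) \<longleftrightarrow> (\<exists>t\<in>T. L < X t \<omega>)"
proof
  define S where "S = {t\<in>T. L < X t \<omega>}"
  assume "\<exists>t\<in>T. L < X t \<omega>"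
  then have "finite S" "S \<noteq> {}"
    using assms by (auto simp: S_def)
  then have "Max S \<in> S" "\<And>u. u \<in> S \<Longrightarrow> u \<le> Max S"
    by auto
  then show "\<exists>t\<in>T. last_exceedance X T L t \<omega>"
    by (intro bexI[of _ "Max S"]) (force simp: S_def last_exceedance_def)+
qed (auto simp: last_exceedance_def)

lemma last_exceedance_unique:
  assumes "last_exceedance X T L t \<omega>" "last_exceedance X T L u \<omega>" "t \<in> T" "u \<in> T"
  shows "t = u"
  using assms by (cases t u rule: linorder_cases) (auto simp: last_exceedance_def)

lemma pred_last_exceedance:
  assumes "finite T" "t \<in> T" "\<And>u. u \<in> T \<Longrightarrow> t \<le> u \<Longrightarrow> X u \<in> borel_measurable N"
  shows "Measurable.pred N (last_exceedance X T L t)"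
proof -
  have [measurable]: "X t \<in> borel_measurable N" "\<And>u. u \<in> {u\<in>T. t < u} \<Longrightarrow> X u \<in> borel_measurable N"
    and finite_later: "finite {u\<in>T. t < u}"
    using assms by auto
  have "Measurable.pred N (\<lambda>\<omega>. L < X t \<omega> \<and> (\<forall>u\<in>{u\<in>T. t < u}. X u \<omega> \<le> L))"
    using finite_later by measurable
  then show ?thesis
    by (simp add: last_exceedance_def[abs_def] Ball_def imp_conjL)
qed

lemma integrable_imp_set_integrable:
  fixes f :: "'a \<Rightarrow> 'b::{banach, second_countable_topology}"
  shows "A \<in> sets M \<Longrightarrow> integrable M f \<Longrightarrow> set_integrable M A f"
  unfolding set_integrable_def by (rule integrable_mult_indicator)

lemma (in finite_measure) jensen_set_integral:
  fixes Y :: "'a \<Rightarrow> real" and \<phi> :: "real \<Rightarrow> real"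
  assumes sets: "A \<in> sets M" and integrable: "integrable M Y" "integrable M (\<lambda>\<omega>. \<phi> (Y \<omega>))"
    and supporting_line: "\<And>y. \<phi> L + c * (y - L) \<le> \<phi> y" and slope_nonneg: "0 \<le> c"
    and mean_ge: "L * measure M A \<le> (LINT \<omega>:A|M. Y \<omega>)"
  shows "\<phi> L * measure M A \<le> (LINT \<omega>:A|M. \<phi> (Y \<omega>))"
proof -
  note set_integrable = integrable_imp_set_integrable[OF sets]
  have "\<phi> L * measure M A \<le> \<phi> L * measure M A + c * ((LINT \<omega>:A|M. Y \<omega>) - L * measure M A)"
    using slope_nonneg mean_ge by simp
  also have "\<dots> = (LINT \<omega>:A|M. \<phi> L + c * (Y \<omega> - L))"
    using sets integrable(1) by (simp add: set_integrable set_integral_const)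
  also have "\<dots> \<le> (LINT \<omega>:A|M. \<phi> (Y \<omega>))"
    using integrable supporting_line by (intro set_integral_mono set_integrable) auto
  finally show ?thesis .
qed

lemma (in finite_measure) reverse_submartingale_maximal_inequality:
  fixes X :: "'t::linorder \<Rightarrow> 'a \<Rightarrow> real" and \<phi> :: "real \<Rightarrow> real"
  assumes finite_times: "finite T" and integrable_X: "\<And>t. t \<in> T \<Longrightarrow> integrable M (X t)"
    and integrable_Y: "integrable M Y" "integrable M (\<lambda>\<omega>. \<phi> (Y \<omega>))"
    and submartingale: "\<And>t. t \<in> T \<Longrightarrow>
      (LINT \<omega>:{\<omega>\<in>space M. last_exceedance X T L t \<omega>}|M. X t \<omega>)
        \<le> (LINT \<omega>:{\<omega>\<in>space M. last_exceedance X T L t \<omega>}|M. Y \<omega>)"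
    and nonneg: "\<And>y. 0 \<le> \<phi> y"
    and supporting_line: "\<And>y. \<phi> L + c * (y - L) \<le> \<phi> y" and slope_nonneg: "0 \<le> c"
  shows "\<phi> L * measure M {\<omega>\<in>space M. \<exists>t\<in>T. L < X t \<omega>} \<le> (LINT \<omega>|M. \<phi> (Y \<omega>))"
proof -
  define E where "E t = {\<omega>\<in>space M. last_exceedance X T L t \<omega>}" for t
  have E_sets: "E t \<in> sets M" if "t \<in> T" for t
    unfolding E_def pred_def[symmetric] using finite_times that integrable_X
    by (intro pred_last_exceedance) auto
  have E_disjoint: "disjoint_family_on E T"
    unfolding disjoint_family_on_def E_def using last_exceedance_unique[of X T L] by blast
  have jensen_on_E: "\<phi> L * measure M (E t) \<le> (LINT \<omega>:E t|M. \<phi> (Y \<omega>))" if t: "t \<in> T" for t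
  proof (rule jensen_set_integral[OF E_sets[OF t] integrable_Y supporting_line slope_nonneg])
    have "L * measure M (E t) = (LINT \<omega>:E t|M. L)"
      using E_sets[OF t] by (simp add: set_integral_const)
    also have "\<dots> \<le> (LINT \<omega>:E t|M. X t \<omega>)"
      using t integrable_X E_sets
      by (intro set_integral_mono integrable_imp_set_integrable) (auto simp: E_def last_exceedance_def)
    also have "\<dots> \<le> (LINT \<omega>:E t|M. Y \<omega>)"
      unfolding E_def by (rule submartingale[OF t])
    finally show "L * measure M (E t) \<le> (LINT \<omega>:E t|M. Y \<omega>)" .
  qed
  have "{\<omega>\<in>space M. \<exists>t\<in>T. L < X t \<omega>} = (\<Union>t\<in>T. E t)"
    using Ex_last_exceedance_iff[OF finite_times, of X L] by (auto simp: E_def)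
  then have "\<phi> L * measure M {\<omega>\<in>space M. \<exists>t\<in>T. L < X t \<omega>} = (\<Sum>t\<in>T. \<phi> L * measure M (E t))"
    using finite_times E_disjoint E_sets
    by (simp add: finite_measure_finite_Union image_subset_iff sum_distrib_left)
  also have "\<dots> \<le> (\<Sum>t\<in>T. LINT \<omega>:E t|M. \<phi> (Y \<omega>))"
    by (intro sum_mono jensen_on_E)
  also have "\<dots> = (LINT \<omega>:(\<Union>t\<in>T. E t)|M. \<phi> (Y \<omega>))"
    using finite_times E_disjoint E_sets integrable_Y
    by (intro set_integral_finite_Union[symmetric] integrable_imp_set_integrable)
  also have "\<dots> \<le> (LINT \<omega>|M. \<phi> (Y \<omega>))"
    unfolding set_lebesgue_integral_def using finite_times E_sets integrable_Y nonneg
    by (intro integral_mono integrable_mult_indicator sets.finite_UN) (auto simp: indicator_def)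
  finally show ?thesis .
qed

section \<open>Counting sample points\<close>

definition sample_count :: "('i \<Rightarrow> 'a \<Rightarrow> real) \<Rightarrow> 'i set \<Rightarrow> real \<Rightarrow> 'a \<Rightarrow> real" where
  "sample_count U I t \<omega> = (\<Sum>i\<in>I. indicator {..t} (U i \<omega>))"

lemma sample_count_eq_card:
  "finite I \<Longrightarrow> sample_count U I t \<omega> = real (card {i\<in>I. U i \<omega> \<le> t})"
  by (simp add: sample_count_def indicator_def sum.If_cases Int_def)

lemma sample_count_nonneg: "0 \<le> sample_count U I t \<omega>"
  by (simp add: sample_count_def sum_nonneg)

lemma sample_count_le_card: "sample_count U I t \<omega> \<le> real (card I)"
  unfolding sample_count_def
  by (rule order_trans[OF sum_bounded_above[where K = 1]]) (auto simp: indicator_def)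

lemma mono_sample_count: "mono (\<lambda>t. sample_count U I t \<omega>)"
  unfolding sample_count_def by (intro monoI sum_mono) (auto simp: indicator_def)

lemma sample_count_remove:
  "finite I \<Longrightarrow> i \<in> I \<Longrightarrow> sample_count U I t \<omega> = indicator {..t} (U i \<omega>) + sample_count U (I - {i}) t \<omega>"
  unfolding sample_count_def by (rule sum.remove)

lemma sample_count_restrict:
  "sample_count (\<lambda>i v. v i) I t (restrict (\<lambda>i. U i \<omega>) I) = sample_count U I t \<omega>"
  by (simp add: sample_count_def cong: sum.cong)

lemma borel_measurable_sample_count [measurable (raw)]:
  "(\<And>i. i \<in> I \<Longrightarrow> U i \<in> borel_measurable N) \<Longrightarrow> sample_count U I t \<in> borel_measurable N"
  unfolding sample_count_def[abs_def] by measurable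

lemma Ex_sample_count_gt_iff:
  assumes "finite I"
  shows "(\<exists>t\<in>S. c t < sample_count U I t \<omega>) \<longleftrightarrow>
    (\<exists>J\<in>Pow I. \<exists>t\<in>{t\<in>S. c t < real (card J)}. \<forall>i\<in>J. U i \<omega> \<le> t)"
proof
  assume "\<exists>t\<in>S. c t < sample_count U I t \<omega>"
  then obtain t where "t \<in> S" "c t < sample_count U I t \<omega>"
    by blast
  then show "\<exists>J\<in>Pow I. \<exists>t\<in>{t\<in>S. c t < real (card J)}. \<forall>i\<in>J. U i \<omega> \<le> t"
    using assms by (intro bexI[of _ "{i\<in>I. U i \<omega> \<le> t}"] bexI[of _ t]) (auto simp: sample_count_eq_card)
next
  assume "\<exists>J\<in>Pow I. \<exists>t\<in>{t\<in>S. c t < real (card J)}. \<forall>i\<in>J. U i \<omega> \<le> t"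
  then obtain J t where "J \<subseteq> I" "\<forall>i\<in>J. U i \<omega> \<le> t" and exceeds: "t \<in> S" "c t < card J"
    by blast
  then have "card J \<le> card {i\<in>I. U i \<omega> \<le> t}"
    using assms by (intro card_mono) auto
  then show "\<exists>t\<in>S. c t < sample_count U I t \<omega>"
    using exceeds assms by (intro bexI[of _ t]) (auto simp: sample_count_eq_card)
qed

lemma sets_Ex_le:
  fixes Y :: "'a \<Rightarrow> real"
  assumes [measurable]: "Y \<in> borel_measurable N"
  shows "{\<omega>\<in>space N. \<exists>t\<in>S. Y \<omega> \<le> t} \<in> sets N"
proof -
  have "is_interval {x. \<exists>t\<in>S. x \<le> t}"
    unfolding is_interval_1 using order_trans by blast
  then have [measurable]: "{x. \<exists>t\<in>S. x \<le> t} \<in> sets borel"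
    by (rule real_interval_borel_measurable)
  have "{\<omega>\<in>space N. Y \<omega> \<in> {x. \<exists>t\<in>S. x \<le> t}} \<in> sets N"
    by measurable
  then show ?thesis
    by simp
qed

lemma sets_Ex_Ball_le:
  fixes U :: "'i \<Rightarrow> 'a \<Rightarrow> real"
  assumes "finite J" "\<And>i. i \<in> J \<Longrightarrow> U i \<in> borel_measurable N"
  shows "{\<omega>\<in>space N. \<exists>t\<in>S. \<forall>i\<in>J. U i \<omega> \<le> t} \<in> sets N"
proof (cases "J = {}")
  case False
  have "{\<omega>\<in>space N. \<exists>t\<in>S. \<forall>i\<in>J. U i \<omega> \<le> t} = {\<omega>\<in>space N. \<exists>t\<in>S. Max ((\<lambda>i. U i \<omega>) ` J) \<le> t}"
    using assms(1) False by simp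
  also have "\<dots> \<in> sets N"
    using assms by (intro sets_Ex_le borel_measurable_Max)
  finally show ?thesis .
qed simp

lemma sets_Ex_sample_count_gt:
  assumes "finite I" "\<And>i. i \<in> I \<Longrightarrow> U i \<in> borel_measurable N"
  shows "{\<omega>\<in>space N. \<exists>t\<in>S. c t < sample_count U I t \<omega>} \<in> sets N"
  unfolding Ex_sample_count_gt_iff[OF assms(1)]
proof (rule sets.sets_Collect_finite_Ex)
  fix J assume "J \<in> Pow I"
  then have "J \<subseteq> I" "finite J"
    using assms(1) finite_subset by auto
  then show "{\<omega>\<in>space N. \<exists>t\<in>{t\<in>S. c t < real (card J)}. \<forall>i\<in>J. U i \<omega> \<le> t} \<in> sets N"
    using assms(2) by (intro sets_Ex_Ball_le) auto
qed (use assms(1) in simp)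

lemma mono_Ex_ratio_gt_iff_Rats:
  fixes f :: "real \<Rightarrow> real"
  assumes "mono f" "0 < a"
  shows "(\<exists>t\<in>{a..<b}. L < f t / t) \<longleftrightarrow> (\<exists>t\<in>{a..<b} \<inter> \<rat>. L < f t / t)"
proof
  assume "\<exists>t\<in>{a..<b}. L < f t / t"
  then obtain t where t_bounds: "a \<le> t" "t < b" and exceeds: "L < f t / t"
    by auto
  have "((\<lambda>q. f t / q) \<longlongrightarrow> f t / t) (at_right t)"
    using assms(2) t_bounds by (intro tendsto_intros) auto
  then have "\<forall>\<^sub>F q in at_right t. L < f t / q"
    using exceeds by (rule order_tendstoD)
  then obtain b' where b': "t < b'" "\<And>q. t < q \<Longrightarrow> q < b' \<Longrightarrow> L < f t / q"
    using t_bounds(2) by (auto simp: eventually_at_right)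
  obtain q where q: "q \<in> \<rat>" "t < q" "q < min b b'"
    using Rats_dense_in_real[of t "min b b'"] t_bounds b' by auto
  have "L < f t / q"
    using b' q by auto
  also have "\<dots> \<le> f q / q"
    using assms(2) t_bounds q by (intro divide_right_mono monoD[OF assms(1)]) auto
  finally show "\<exists>t\<in>{a..<b} \<inter> \<rat>. L < f t / t"
    using q t_bounds by (intro bexI[of _ q]) auto
qed auto

lemma (in finite_measure) set_integral_sample_count:
  assumes measurable_U: "\<And>i. i \<in> I \<Longrightarrow> U i \<in> borel_measurable M" and [measurable]: "A \<in> sets M"
  shows "(LINT \<omega>:A|M. sample_count U I t \<omega>) = (\<Sum>i\<in>I. measure M ({\<omega>\<in>space M. U i \<omega> \<le> t} \<inter> A))"
proof -
  have sublevel_sets: "{\<omega>\<in>space M. U i \<omega> \<le> t} \<inter> A \<in> sets M" if "i \<in> I" for i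
  proof -
    have [measurable]: "U i \<in> borel_measurable M"
      by (rule measurable_U[OF that])
    show ?thesis
      by measurable
  qed
  have "(LINT \<omega>:A|M. sample_count U I t \<omega>)
      = (LINT \<omega>|M. (\<Sum>i\<in>I. indicator ({\<omega>\<in>space M. U i \<omega> \<le> t} \<inter> A) \<omega>))"
    unfolding set_lebesgue_integral_def sample_count_def
    by (intro Bochner_Integration.integral_cong) (auto simp: sum_distrib_left indicator_def intro!: sum.cong)
  also have "\<dots> = (\<Sum>i\<in>I. LINT \<omega>|M. indicator ({\<omega>\<in>space M. U i \<omega> \<le> t} \<inter> A) \<omega>)"
    using sublevel_sets by (intro Bochner_Integration.integral_sum) (auto simp: less_top[symmetric])
  also have "\<dots> = (\<Sum>i\<in>I. measure M ({\<omega>\<in>space M. U i \<omega> \<le> t} \<inter> A))"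
    by (intro sum.cong refl) (auto intro!: arg_cong[where f = "measure M"])
  finally show ?thesis .
qed

lemma (in finite_measure) integrable_sample_count:
  assumes "\<And>i. i \<in> I \<Longrightarrow> U i \<in> borel_measurable M"
  shows "integrable M (sample_count U I t)"
  using assms
  by (intro integrable_const_bound[where B = "card I"] borel_measurable_sample_count)
    (auto simp: sample_count_nonneg sample_count_le_card)

lemma (in finite_measure) integrable_exp_sample_count:
  assumes "\<And>i. i \<in> I \<Longrightarrow> U i \<in> borel_measurable M"
  shows "integrable M (\<lambda>\<omega>. exp (\<theta> * sample_count U I t \<omega>))"
proof (rule integrable_const_bound[where B = "exp (\<bar>\<theta>\<bar> * card I)"])
  have "\<theta> * sample_count U I t \<omega> \<le> \<bar>\<theta>\<bar> * card I" for \<omega>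
    by (intro mult_mono sample_count_le_card sample_count_nonneg) auto
  then show "AE \<omega> in M. norm (exp (\<theta> * sample_count U I t \<omega>)) \<le> exp (\<bar>\<theta>\<bar> * card I)"
    by simp
next
  have [measurable]: "sample_count U I t \<in> borel_measurable M"
    using assms by (rule borel_measurable_sample_count)
  show "(\<lambda>\<omega>. exp (\<theta> * sample_count U I t \<omega>)) \<in> borel_measurable M"
    by measurable
qed

section \<open>The inverse of \<open>h\<close> and dyadic levels\<close>

lemma h_inv_gt_1: "0 < y \<Longrightarrow> 1 < h_inv y"
  using bij_betwE[OF bij_betw_the_inv_into[OF h_bij_betw]] by (auto simp: h_inv_def)

lemma h_h_inv: "0 < y \<Longrightarrow> h (h_inv y) = y"
  using f_the_inv_into_f_bij_betw[OF h_bij_betw, of y] by (simp add: h_inv_def)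

lemma h_inv_mono:
  assumes "0 < x" "x \<le> y"
  shows "h_inv x \<le> h_inv y"
proof (rule ccontr)
  assume "\<not> h_inv x \<le> h_inv y"
  then have "h (h_inv y) < h (h_inv x)"
    using assms h_inv_gt_1 by (intro strict_mono_onD[OF h_strict_mono_on]) auto
  then show False
    using assms by (simp add: h_h_inv)
qed

lemma kappa_gt_1: "1 < kappa"
proof -
  have "3 * 3 < pi * pi"
    using pi_gt3 by (intro mult_strict_mono) auto
  then show ?thesis
    by (simp add: kappa_def power2_eq_square)
qed

definition dyadic_risk :: "real \<Rightarrow> nat \<Rightarrow> real" where
  "dyadic_risk \<delta> k = \<delta> / (kappa * (real k)\<^sup>2)"

lemma dyadic_risk_sums: "(\<lambda>k. dyadic_risk \<delta> (Suc k)) sums \<delta>"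
  using sums_mult[OF inverse_squares_sums, of "\<delta> / kappa"] kappa_gt_1
  by (simp add: dyadic_risk_def kappa_def add.commute)

lemma dyadic_risk_bounds:
  assumes "0 < \<delta>" "\<delta> < 1" "1 \<le> k"
  shows "0 < dyadic_risk \<delta> k" "dyadic_risk \<delta> k < 1"
proof -
  have "kappa * 1 \<le> kappa * (real k)\<^sup>2"
    using assms(3) kappa_gt_1 by (intro mult_left_mono) auto
  then have "1 < kappa * (real k)\<^sup>2"
    using kappa_gt_1 by linarith
  then show "0 < dyadic_risk \<delta> k" "dyadic_risk \<delta> k < 1"
    using assms by (auto simp: dyadic_risk_def)
qed

lemma ln_inverse_dyadic_risk:
  assumes "0 < \<delta>" "1 \<le> k"
  shows "ln (1 / dyadic_risk \<delta> k) = ln (kappa / \<delta>) + 2 * ln (real k)"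
proof -
  have "ln (1 / dyadic_risk \<delta> k) = ln (kappa / \<delta> * (real k)\<^sup>2)"
    by (simp add: dyadic_risk_def)
  also have "\<dots> = ln (kappa / \<delta>) + ln ((real k)\<^sup>2)"
    using assms kappa_gt_1 by (intro ln_mult_pos) auto
  finally show ?thesis
    using assms by (simp add: ln_realpow)
qed

definition dyadic_floor :: "real \<Rightarrow> real" where
  "dyadic_floor t = 2 powr (- real_of_int (dyadic_level t))"

lemma g_eq_odds: "g t = odds (dyadic_floor t)"
  by (simp add: g_def odds_def dyadic_floor_def)

lemma dyadic_level_ge_1:
  assumes "0 < t" "t < 1"
  shows "1 \<le> dyadic_level t"
proof -
  have "0 < log 2 (1 / t)"
    using assms by simp
  then show ?thesis
    unfolding dyadic_level_def by linarith
qed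

lemma dyadic_level_le: "real_of_int (dyadic_level t) \<le> 1 + log 2 (1 / t)"
  unfolding dyadic_level_def by linarith

lemma dyadic_floor_le:
  assumes "0 < t"
  shows "dyadic_floor t \<le> t"
proof -
  have "log 2 (1 / t) \<le> dyadic_level t"
    unfolding dyadic_level_def by linarith
  then have "2 powr (- real_of_int (dyadic_level t)) \<le> 2 powr (log 2 t)"
    using assms by (intro powr_mono) (auto simp: log_divide)
  then show ?thesis
    using assms by (simp add: dyadic_floor_def)
qed

lemma half_le_dyadic_floor:
  assumes "0 < t"
  shows "t / 2 \<le> dyadic_floor t"
proof -
  have "2 powr (log 2 t - 1) \<le> 2 powr (- real_of_int (dyadic_level t))"
    using assms dyadic_level_le[of t] by (intro powr_mono) (auto simp: log_divide)
  then show ?thesis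
    using assms by (simp add: dyadic_floor_def powr_diff)
qed

lemma half_le_g:
  assumes "0 < t" "t < 1"
  shows "t / 2 \<le> g t"
proof -
  have "t / 2 \<le> dyadic_floor t"
    using assms(1) by (rule half_le_dyadic_floor)
  also have "\<dots> \<le> g t"
    unfolding g_eq_odds using assms dyadic_floor_le[of t]
    by (intro le_odds) (auto simp: dyadic_floor_def)
  finally show ?thesis .
qed

definition dyadic_rate :: "nat \<Rightarrow> real \<Rightarrow> real \<Rightarrow> real" where
  "dyadic_rate n \<delta> t = (ln (kappa / \<delta>) + 2 * ln (real_of_int (dyadic_level t))) / (real n * g t)"

definition log_rate :: "nat \<Rightarrow> real \<Rightarrow> real \<Rightarrow> real" where
  "log_rate n \<delta> t = (2 * ln (kappa / \<delta>) + 4 * ln (1 + log 2 (1 / t))) / (real n * t)"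

lemma h_inv_dyadic_rate_le:
  assumes \<delta>_bounds: "0 < \<delta>" "\<delta> < 1" and n_pos: "0 < n" and t_bounds: "0 < t" "t < 1"
  shows "h_inv (dyadic_rate n \<delta> t) \<le> h_inv (log_rate n \<delta> t)"
proof (rule h_inv_mono)
  define L where "L = ln (kappa / \<delta>)"
  define k where "k = real_of_int (dyadic_level t)"
  have L_pos: "0 < L"
    using kappa_gt_1 \<delta>_bounds by (simp add: L_def)
  have k_bounds: "1 \<le> k" "k \<le> 1 + log 2 (1 / t)"
    using dyadic_level_ge_1[OF t_bounds] dyadic_level_le[of t] by (auto simp: k_def)
  have g_bounds: "t / 2 \<le> g t" "0 < g t"
    using half_le_g[OF t_bounds] t_bounds by auto
  have rate_eq: "dyadic_rate n \<delta> t = (L + 2 * ln k) / (n * g t)"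
    by (simp add: dyadic_rate_def L_def k_def)
  show "0 < dyadic_rate n \<delta> t"
    unfolding rate_eq using L_pos n_pos k_bounds g_bounds
    by (intro divide_pos_pos add_pos_nonneg mult_pos_pos) auto
  have "dyadic_rate n \<delta> t \<le> (L + 2 * ln (1 + log 2 (1 / t))) / (n * (t / 2))"
    unfolding rate_eq using L_pos n_pos k_bounds g_bounds t_bounds
    by (intro frac_le mult_left_mono add_mono add_nonneg_nonneg mult_pos_pos) auto
  also have "\<dots> = log_rate n \<delta> t"
    using n_pos t_bounds by (simp add: log_rate_def L_def field_simps)
  finally show "dyadic_rate n \<delta> t \<le> log_rate n \<delta> t" .
qed

section \<open>Uniform samples\<close>

lemma (in prob_space) prob_compl_UN_ge:
  fixes A :: "nat \<Rightarrow> 'a set"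
  assumes events: "\<And>k. A k \<in> events" and prob_le: "\<And>k. prob (A k) \<le> p k" and sums: "p sums \<delta>"
  shows "1 - \<delta> \<le> prob (space M - (\<Union>k. A k))"
proof -
  have summable: "summable (\<lambda>k. prob (A k))"
    using prob_le by (intro summable_comparison_test'[OF sums_summable[OF sums]]) auto
  then have "prob (\<Union>k. A k) \<le> (\<Sum>k. prob (A k))"
    using events by (intro finite_measure_subadditive_countably) auto
  also have "\<dots> \<le> (\<Sum>k. p k)"
    using prob_le summable by (intro suminf_le sums_summable[OF sums])
  also have "\<dots> = \<delta>"
    using sums by (rule sums_unique[symmetric])
  finally show ?thesis
    using events by (subst prob_compl) auto
qed

lemma (in prob_space) expectation_exp_indicator:
  assumes "A \<in> events"
  shows "expectation (\<lambda>\<omega>. exp (\<theta> * indicator A \<omega>)) = 1 - prob A + prob A * exp \<theta>"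
proof -
  have "expectation (\<lambda>\<omega>. exp (\<theta> * indicator A \<omega>)) = expectation (\<lambda>\<omega>. 1 + (exp \<theta> - 1) * indicator A \<omega>)"
    by (intro Bochner_Integration.integral_cong) (auto simp: indicator_def)
  also have "\<dots> = 1 - prob A + prob A * exp \<theta>"
    using assms by (subst Bochner_Integration.integral_add)
      (auto simp: prob_space less_top[symmetric] algebra_simps)
  finally show ?thesis .
qed

lemma (in prob_space) prob_indep_vars_remaining:
  assumes "indep_vars M' X I" "i \<in> I"
    and C_sets: "C \<in> sets (M' i)" and D_sets: "D \<in> sets (PiM (I - {i}) M')"
  shows "prob {\<omega>\<in>space M. X i \<omega> \<in> C \<and> restrict (\<lambda>j. X j \<omega>) (I - {i}) \<in> D}
    = prob {\<omega>\<in>space M. X i \<omega> \<in> C} * prob {\<omega>\<in>space M. restrict (\<lambda>j. X j \<omega>) (I - {i}) \<in> D}"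
proof -
  let ?only = "\<lambda>\<omega>. restrict (\<lambda>j. X j \<omega>) {i}" and ?rest = "\<lambda>\<omega>. restrict (\<lambda>j. X j \<omega>) (I - {i})"
  define C' where "C' = (\<lambda>v. v i) -` C \<inter> space (PiM {i} M')"
  have "C' \<in> sets (PiM {i} M')"
    unfolding C'_def using C_sets by (rule measurable_sets[rotated]) measurable
  moreover have "indep_var (PiM {i} M') ?only (PiM (I - {i}) M') ?rest"
    using assms by (intro indep_var_restrict) auto
  ultimately have "prob ((\<lambda>\<omega>. (?only \<omega>, ?rest \<omega>)) -` (C' \<times> D) \<inter> space M)
      = prob (?only -` C' \<inter> space M) * prob (?rest -` D \<inter> space M)"
    using D_sets by (intro indep_varD)
  moreover have "?only \<omega> \<in> C' \<longleftrightarrow> X i \<omega> \<in> C" for \<omega>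
    using sets.sets_into_space[OF C_sets] by (auto simp: C'_def space_PiM)
  ultimately show ?thesis
    by (simp add: vimage_def Int_def conj_commute)
qed

locale uniform_sample = prob_space M
  for M :: "'a measure" +
  fixes U :: "'i \<Rightarrow> 'a \<Rightarrow> real" and I :: "'i set"
  assumes finite_index: "finite I"
    and indep: "indep_vars (\<lambda>_. borel) U I"
    and uniform: "\<And>i. i \<in> I \<Longrightarrow> distr M borel (U i) = uniform_measure lborel {0<..<1}"
begin

abbreviation cnt :: "real \<Rightarrow> 'a \<Rightarrow> real" where
  "cnt \<equiv> sample_count U I"

definition future :: "real \<Rightarrow> 'a measure" where
  "future t = vimage_algebra (space M) (\<lambda>\<omega>. \<lambda>u\<in>{t..}. cnt u \<omega>) (PiM {t..} (\<lambda>_. borel))"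

lemma random_variable_U [measurable]: "i \<in> I \<Longrightarrow> random_variable borel (U i)"
  using indep by (simp add: indep_vars_def)

lemma sets_future_subset: "sets (future t) \<subseteq> events"
  unfolding future_def by (rule sets_image_in_sets) measurable

lemma measurable_cnt_future:
  assumes "t \<le> u"
  shows "cnt u \<in> borel_measurable (future t)"
proof -
  have "(\<lambda>\<omega>. \<lambda>u\<in>{t..}. cnt u \<omega>) \<in> measurable (future t) (PiM {t..} (\<lambda>_. borel))"
    unfolding future_def by (rule measurable_vimage_algebra1) (auto simp: space_PiM)
  from measurable_compose[OF this measurable_component_singleton, of u] show ?thesis
    using assms by simp
qed

lemma prob_U_le:
  assumes "i \<in> I" "0 \<le> t" "t < 1"
  shows "prob {\<omega>\<in>space M. U i \<omega> \<le> t} = t"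
proof -
  have "prob {\<omega>\<in>space M. U i \<omega> \<le> t} = measure (distr M borel (U i)) {..t}"
    using assms(1) by (subst measure_distr) (auto intro!: arg_cong[where f = prob])
  also have "\<dots> = measure lborel ({0<..<1} \<inter> {..t})"
    using uniform[OF assms(1)] by simp
  also have "{0<..<1} \<inter> {..t} = {0<..t}"
    using assms by auto
  finally show ?thesis
    using assms by simp
qed

text \<open>On \<open>U i \<le> t\<close> the counts at levels from \<open>t\<close> upwards depend only on the other variables,
  hence the location of \<open>U i\<close> below \<open>t\<close> is independent of them.\<close>

lemma prob_U_le_Int_future:
  assumes index: "i \<in> I" and A_future: "A \<in> sets (future t)" and "0 < s" "s \<le> t" "t < 1"
  shows "t * prob ({\<omega>\<in>space M. U i \<omega> \<le> s} \<inter> A) = s * prob ({\<omega>\<in>space M. U i \<omega> \<le> t} \<inter> A)"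
proof -
  define other where "other \<omega> = restrict (\<lambda>j. U j \<omega>) (I - {i})" for \<omega>
  define counts where "counts v = (\<lambda>u\<in>{t..}. 1 + sample_count (\<lambda>j v. v j) (I - {i}) u v)" for v
  obtain B where B_sets: "B \<in> sets (PiM {t..} (\<lambda>_. borel))"
    and A_eq: "A = (\<lambda>\<omega>. \<lambda>u\<in>{t..}. cnt u \<omega>) -` B \<inter> space M"
    using A_future unfolding future_def by (subst (asm) sets_vimage_algebra2) (auto simp: space_PiM)
  define D where "D = counts -` B \<inter> space (PiM (I - {i}) (\<lambda>_. borel))"
  have D_sets: "D \<in> sets (PiM (I - {i}) (\<lambda>_. borel))"
    unfolding D_def counts_def[abs_def] using B_sets by (rule measurable_sets[rotated]) measurable
  have product: "prob ({\<omega>\<in>space M. U i \<omega> \<le> r} \<inter> A) = r * prob {\<omega>\<in>space M. other \<omega> \<in> D}"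
    if "0 < r" "r \<le> t" for r
  proof -
    have "(\<lambda>u\<in>{t..}. cnt u \<omega>) = counts (other \<omega>)" if "U i \<omega> \<le> r" for \<omega>
      using that \<open>r \<le> t\<close> index finite_index
      by (auto simp: counts_def other_def sample_count_restrict sample_count_remove[where i = i] indicator_def)
    then have "{\<omega>\<in>space M. U i \<omega> \<le> r} \<inter> A = {\<omega>\<in>space M. U i \<omega> \<in> {..r} \<and> other \<omega> \<in> D}"
      by (auto simp: A_eq D_def other_def space_PiM)
    also have "prob \<dots> = prob {\<omega>\<in>space M. U i \<omega> \<in> {..r}} * prob {\<omega>\<in>space M. other \<omega> \<in> D}"
      unfolding other_def using index D_sets by (intro prob_indep_vars_remaining[OF indep]) auto
    also have "prob {\<omega>\<in>space M. U i \<omega> \<in> {..r}} = r"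
      using prob_U_le[OF index, of r] that \<open>t < 1\<close> by simp
    finally show ?thesis .
  qed
  show ?thesis
    using product[of s] product[of t] assms by simp
qed

lemma cnt_reverse_martingale:
  assumes "A \<in> sets (future t)" "0 < s" "s \<le> t" "t < 1"
  shows "(LINT \<omega>:A|M. cnt s \<omega> / s) = (LINT \<omega>:A|M. cnt t \<omega> / t)"
proof -
  have "A \<in> events"
    using assms(1) sets_future_subset by blast
  then have set_integral_cnt:
    "(LINT \<omega>:A|M. cnt r \<omega>) = (\<Sum>i\<in>I. prob ({\<omega>\<in>space M. U i \<omega> \<le> r} \<inter> A))" for r
    by (intro set_integral_sample_count random_variable_U)
  have "t * (LINT \<omega>:A|M. cnt s \<omega>) = s * (LINT \<omega>:A|M. cnt t \<omega>)"
    unfolding set_integral_cnt sum_distrib_left by (intro sum.cong refl prob_U_le_Int_future assms)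
  then show ?thesis
    using assms by (simp add: field_simps)
qed

lemma expectation_exp_cnt:
  assumes "0 \<le> a" "a < 1"
  shows "expectation (\<lambda>\<omega>. exp (\<theta> * cnt a \<omega>)) = (1 - a + a * exp \<theta>) ^ card I"
proof -
  define Z where "Z i \<omega> = exp (\<theta> * indicator {..a} (U i \<omega>))" for i \<omega>
  have expectation_Z: "expectation (Z i) = 1 - a + a * exp \<theta>" if "i \<in> I" for i
  proof -
    have "{\<omega>\<in>space M. U i \<omega> \<le> a} \<in> events"
      using that by measurable
    then have "expectation (\<lambda>\<omega>. exp (\<theta> * indicator {\<omega>\<in>space M. U i \<omega> \<le> a} \<omega>)) = 1 - a + a * exp \<theta>"
      using prob_U_le[OF that assms] by (simp add: expectation_exp_indicator)
    then show ?thesis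
      unfolding Z_def by (simp add: indicator_def cong: Bochner_Integration.integral_cong)
  qed
  have "integrable M (Z i)" if "i \<in> I" for i
    using that integrable_exp_sample_count[of "{i}" U \<theta> a] by (simp add: Z_def[abs_def] sample_count_def)
  moreover have "indep_vars (\<lambda>_. borel) Z I"
    unfolding Z_def[abs_def] using indep by (rule indep_vars_compose2) measurable
  ultimately have "expectation (\<lambda>\<omega>. \<Prod>i\<in>I. Z i \<omega>) = (\<Prod>i\<in>I. expectation (Z i))"
    using finite_index by (intro indep_vars_lebesgue_integral)
  also have "\<dots> = (1 - a + a * exp \<theta>) ^ card I"
    using expectation_Z by simp
  finally show ?thesis
    by (simp add: Z_def sample_count_def exp_sum[OF finite_index] sum_distrib_left)
qed

lemma finite_exp_maximal_inequality:
  assumes "0 < a" "finite T" "T \<subseteq> {a..<1}" "0 \<le> s"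
  shows "exp (s * L) * prob {\<omega>\<in>space M. \<exists>t\<in>T. L < cnt t \<omega> / t}
    \<le> expectation (\<lambda>\<omega>. exp (s * (cnt a \<omega> / a)))"
proof (rule reverse_submartingale_maximal_inequality[where \<phi> = "\<lambda>y. exp (s * y)"])
  show "integrable M (\<lambda>\<omega>. exp (s * (cnt a \<omega> / a)))"
    using integrable_exp_sample_count[of I U "s / a" a] by simp
  show "(LINT \<omega>:{\<omega>\<in>space M. last_exceedance (\<lambda>t \<omega>. cnt t \<omega> / t) T L t \<omega>}|M. cnt t \<omega> / t)
      \<le> (LINT \<omega>:{\<omega>\<in>space M. last_exceedance (\<lambda>t \<omega>. cnt t \<omega> / t) T L t \<omega>}|M. cnt a \<omega> / a)"
    if "t \<in> T" for t
  proof (rule eq_refl, rule cnt_reverse_martingale[symmetric])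
    have "Measurable.pred (future t) (last_exceedance (\<lambda>t \<omega>. cnt t \<omega> / t) T L t)"
      using assms(2) that measurable_cnt_future
      by (intro pred_last_exceedance borel_measurable_divide) auto
    then show "{\<omega>\<in>space M. last_exceedance (\<lambda>t \<omega>. cnt t \<omega> / t) T L t \<omega>} \<in> sets (future t)"
      by (simp add: pred_def future_def)
  qed (use assms that in auto)
  show "exp (s * L) + s * exp (s * L) * (y - L) \<le> exp (s * y)" for y
  proof -
    have "exp (s * L) * (1 + s * (y - L)) \<le> exp (s * L) * exp (s * (y - L))"
      by (intro mult_left_mono exp_ge_add_one_self) auto
    then show ?thesis
      by (simp add: algebra_simps flip: exp_add)
  qed
qed (use assms in \<open>auto intro!: integrable_sample_count\<close>)

lemma exp_maximal_inequality:
  assumes "0 < a" "0 \<le> s"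
  shows "exp (s * L) * prob {\<omega>\<in>space M. \<exists>t\<in>{a..<1}. L < cnt t \<omega> / t}
    \<le> expectation (\<lambda>\<omega>. exp (s * (cnt a \<omega> / a)))"
proof -
  define A where "A t = {\<omega>\<in>space M. L < cnt t \<omega> / t}" for t
  have UN_A: "(\<Union>t\<in>T. A t) = {\<omega>\<in>space M. \<exists>t\<in>T. L < cnt t \<omega> / t}" for T
    by (auto simp: A_def)
  have "prob (\<Union>t\<in>{a..<1} \<inter> \<rat>. A t) \<le> expectation (\<lambda>\<omega>. exp (s * (cnt a \<omega> / a))) / exp (s * L)"
  proof (rule measure_UN_bound)
    show "A t \<in> fmeasurable M" for t
      unfolding A_def fmeasurable_eq_sets by measurable
    show "prob (\<Union>t\<in>T. A t) \<le> expectation (\<lambda>\<omega>. exp (s * (cnt a \<omega> / a))) / exp (s * L)"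
      if "T \<subseteq> {a..<1} \<inter> \<rat>" "finite T" for T
      using finite_exp_maximal_inequality[of a T s L] that assms
      by (simp add: UN_A pos_le_divide_eq mult.commute)
  qed (auto intro: countable_rat)
  then show ?thesis
    unfolding UN_A mono_Ex_ratio_gt_iff_Rats[OF mono_sample_count assms(1)]
    by (simp add: pos_le_divide_eq mult.commute)
qed

lemma prob_exceedance_le:
  fixes a l :: real
  assumes "0 < a" "a < 1" "1 \<le> l"
  shows "prob {\<omega>\<in>space M. \<exists>t\<in>{a..<1}. l * card I < cnt t \<omega> / t} \<le> exp (- (card I * odds a * h l))"
proof -
  define s where "s = odds a * ln l"
  have s_nonneg: "0 \<le> s" and s_div: "s / a = ln l / (1 - a)"
    using assms by (auto simp: s_def odds_def)
  have "exp (s * (l * card I)) * prob {\<omega>\<in>space M. \<exists>t\<in>{a..<1}. l * card I < cnt t \<omega> / t}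
      \<le> expectation (\<lambda>\<omega>. exp (s * (cnt a \<omega> / a)))"
    by (rule exp_maximal_inequality[OF assms(1) s_nonneg])
  also have "\<dots> = (1 - a + a * exp (s / a)) ^ card I"
    using expectation_exp_cnt[of a "s / a"] assms by simp
  also have "\<dots> \<le> exp (odds a * (exp (ln l) - 1)) ^ card I"
    unfolding s_div using assms by (intro power_mono bernoulli_mgf_le_poisson_mgf) auto
  also have "\<dots> = exp (card I * (odds a * (l - 1)))"
    using assms by (simp add: exp_of_nat_mult)
  finally have "prob {\<omega>\<in>space M. \<exists>t\<in>{a..<1}. l * card I < cnt t \<omega> / t}
      \<le> exp (card I * (odds a * (l - 1))) / exp (s * (l * card I))"
    by (simp add: pos_le_divide_eq mult.commute)
  also have "\<dots> = exp (- (card I * odds a * h l))"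
    unfolding exp_diff[symmetric] by (simp add: h_def s_def algebra_simps)
  finally show ?thesis .
qed

lemma prob_h_inv_exceedance_le:
  assumes "I \<noteq> {}" and a_bounds: "0 < a" "a < 1" and p_bounds: "0 < p" "p < 1"
  shows "prob {\<omega>\<in>space M. \<exists>t\<in>{a..<1}. h_inv (ln (1 / p) / (card I * odds a)) * card I < cnt t \<omega> / t} \<le> p"
proof -
  define y where "y = ln (1 / p) / (card I * odds a)"
  have card_pos: "0 < card I"
    using assms(1) finite_index by (simp add: card_gt_0_iff)
  then have y_pos: "0 < y"
    using p_bounds odds_pos[OF a_bounds] by (simp add: y_def)
  have "prob {\<omega>\<in>space M. \<exists>t\<in>{a..<1}. h_inv y * card I < cnt t \<omega> / t}
      \<le> exp (- (card I * odds a * h (h_inv y)))"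
    using a_bounds h_inv_gt_1[OF y_pos] by (intro prob_exceedance_le) auto
  also have "\<dots> = p"
    using card_pos odds_pos[OF a_bounds] p_bounds unfolding h_h_inv[OF y_pos] by (simp add: y_def ln_div)
  finally show ?thesis
    by (simp add: y_def)
qed

lemma sets_Ex_ratio_gt:
  assumes "0 < a"
  shows "{\<omega>\<in>space M. \<exists>t\<in>{a..<b}. L < cnt t \<omega> / t} \<in> events"
proof -
  have "{\<omega>\<in>space M. \<exists>t\<in>{a..<b}. L < cnt t \<omega> / t} = {\<omega>\<in>space M. \<exists>t\<in>{a..<b}. L * t < cnt t \<omega>}"
    using assms by (auto simp: pos_less_divide_eq)
  also have "\<dots> \<in> events"
    using finite_index random_variable_U by (rule sets_Ex_sample_count_gt)
  finally show ?thesis .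
qed

lemma sets_Ball_frequency_le:
  assumes "I \<noteq> {}"
  shows "{\<omega>\<in>space M. \<forall>t\<in>S. cnt t \<omega> / card I \<le> c t} \<in> events"
proof -
  have "{\<omega>\<in>space M. \<forall>t\<in>S. cnt t \<omega> / card I \<le> c t}
      = space M - {\<omega>\<in>space M. \<exists>t\<in>S. c t * card I < cnt t \<omega>}"
    using assms finite_index by (auto simp: card_gt_0_iff pos_divide_le_eq not_less)
  also have "\<dots> \<in> events"
    using sets_Ex_sample_count_gt[OF finite_index random_variable_U] by (rule sets.compl_sets)
  finally show ?thesis .
qed

lemma dyadic_confidence_bound:
  assumes "I \<noteq> {}" and \<delta>_bounds: "0 < \<delta>" "\<delta> < 1"
  shows "1 - \<delta> \<le> prob {\<omega>\<in>space M. \<forall>t\<in>{0<..<1}. cnt t \<omega> / card I \<le> t * h_inv (dyadic_rate (card I) \<delta> t)}"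
proof -
  define a where "a k = 2 powr (- real (Suc k))" for k
  define y where "y k = ln (1 / dyadic_risk \<delta> (Suc k)) / (card I * odds (a k))" for k
  define B where "B k = {\<omega>\<in>space M. \<exists>t\<in>{a k..<1}. h_inv (y k) * card I < cnt t \<omega> / t}" for k
  have a_bounds: "0 < a k" "a k < 1" for k
    by (auto simp: a_def powr_less_one)
  have "B k \<in> events" for k
    unfolding B_def using a_bounds by (intro sets_Ex_ratio_gt)
  moreover have "prob (B k) \<le> dyadic_risk \<delta> (Suc k)" for k
    unfolding B_def y_def using assms a_bounds
    by (intro prob_h_inv_exceedance_le dyadic_risk_bounds) auto
  ultimately have "1 - \<delta> \<le> prob (space M - (\<Union>k. B k))"
    using dyadic_risk_sums by (rule prob_compl_UN_ge)
  also have "\<dots> \<le> prob {\<omega>\<in>space M. \<forall>t\<in>{0<..<1}. cnt t \<omega> / card I \<le> t * h_inv (dyadic_rate (card I) \<delta> t)}"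
  proof (intro finite_measure_mono sets_Ball_frequency_le[OF assms(1)] subsetI CollectI conjI ballI)
    fix \<omega> t assume outside: "\<omega> \<in> space M - (\<Union>k. B k)" and t_bounds: "t \<in> {0<..<1::real}"
    define k where "k = nat (dyadic_level t) - 1"
    have level_eq: "real_of_int (dyadic_level t) = real (Suc k)"
      using dyadic_level_ge_1[of t] t_bounds by (simp add: k_def)
    then have floor_eq: "dyadic_floor t = a k"
      by (simp add: dyadic_floor_def a_def)
    then have "t \<in> {a k..<1}"
      using t_bounds dyadic_floor_le[of t] by simp
    then have "cnt t \<omega> / t \<le> h_inv (y k) * card I"
      using outside by (force simp: B_def not_less)
    then have "cnt t \<omega> / card I \<le> t * h_inv (y k)"
      using t_bounds assms(1) finite_index by (simp add: field_simps card_gt_0_iff)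
    also have "y k = dyadic_rate (card I) \<delta> t"
      using \<delta>_bounds by (simp add: y_def dyadic_rate_def g_eq_odds floor_eq level_eq ln_inverse_dyadic_risk)
    finally show "cnt t \<omega> / card I \<le> t * h_inv (dyadic_rate (card I) \<delta> t)" .
  qed auto
  finally show ?thesis .
qed

lemma log_confidence_bound:
  assumes "I \<noteq> {}" and \<delta>_bounds: "0 < \<delta>" "\<delta> < 1"
  shows "1 - \<delta> \<le> prob {\<omega>\<in>space M. \<forall>t\<in>{0<..<1}. cnt t \<omega> / card I \<le> t * h_inv (log_rate (card I) \<delta> t)}"
proof -
  have "t * h_inv (dyadic_rate (card I) \<delta> t) \<le> t * h_inv (log_rate (card I) \<delta> t)" if "t \<in> {0<..<1}" for t
    using that assms finite_index
    by (intro mult_left_mono h_inv_dyadic_rate_le) (auto simp: card_gt_0_iff)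
  then have "prob {\<omega>\<in>space M. \<forall>t\<in>{0<..<1}. cnt t \<omega> / card I \<le> t * h_inv (dyadic_rate (card I) \<delta> t)}
      \<le> prob {\<omega>\<in>space M. \<forall>t\<in>{0<..<1}. cnt t \<omega> / card I \<le> t * h_inv (log_rate (card I) \<delta> t)}"
    by (intro finite_measure_mono sets_Ball_frequency_le[OF assms(1)]) (blast intro: order_trans)
  with dyadic_confidence_bound[OF assms] show ?thesis
    by (rule order_trans)
qed

end

theorem proposition6:
  fixes M :: "'a measure" and U :: "nat \<Rightarrow> 'a \<Rightarrow> real" and n :: nat and \<delta> :: real
  assumes "prob_space M"
    and "n \<ge> 1"
    and "prob_space.indep_vars M (\<lambda>_. borel) U {1..n}"
    and "\<And>i. i \<in> {1..n} \<Longrightarrow> distr M borel (U i) = uniform_measure lborel {0<..<1}"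
    and "0 < \<delta>" and "\<delta> < 1"
  shows "measure M {\<omega> \<in> space M. \<forall>t\<in>{0<..<1}.
           (\<Sum>i=1..n. indicator {..t} (U i \<omega>)) / real n
             \<le> t * h_inv ((ln (kappa / \<delta>) + 2 * ln (real_of_int (dyadic_level t))) / (real n * g t))}
         \<ge> 1 - \<delta>
    \<and> (\<forall>t\<in>{0<..<1}. g t \<ge> t / 2)
    \<and> measure M {\<omega> \<in> space M. \<forall>t\<in>{0<..<1}.
           (\<Sum>i=1..n. indicator {..t} (U i \<omega>)) / real n
             \<le> t * h_inv ((2 * ln (kappa / \<delta>) + 4 * ln (1 + log 2 (1 / t))) / (real n * t))}
         \<ge> 1 - \<delta>"
proof -
  interpret prob_space M by fact
  interpret uniform_sample M U "{1..n}"
    using assms by unfold_locales auto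
  have "{1..n} \<noteq> {}"
    using assms(2) by simp
  then show ?thesis
    using dyadic_confidence_bound[OF _ assms(5,6)] log_confidence_bound[OF _ assms(5,6)] half_le_g
    by (simp add: sample_count_def dyadic_rate_def log_rate_def)
qed

end
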